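(* For online one-dimensional bin packing with known optimal cost (K-O), every online algorithm has asymptotic competitive ratio at least $\frac{87}{62}\approx 1.4032258$.
   Context: In one-dimensional bin packing, the input is a sequence of items with rational sizes in $(0,1]$, and the items must be partitioned into bins so that the total size of the items in each bin is at most $1$; the cost is the number of bins used. In the online version, items arrive one by one and each item must be irrevocably assigned to a bin before the next item is revealed. In the K-O (known optimal cost) variant, the online algorithm is told in advance the value $OPT(I)$, the minimum number of bins needed to pack the whole input $I$ (the items themselves are still revealed online). Online algorithms are deterministic. For an algorithm $A$, let $A(I)$ be its cost on input $I$, let $c(Q)=\max\{A(I): OPT(I)=Q\}$, and define the asymptotic competitive ratio of $A$ as $R_A=\limsup_{Q\to\infty} c(Q)/Q$. *)

theory Defs
  imports Complex_Main "HOL-Library.Extended_Real" "HOL-Library.Liminf_Limsup"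
begin

definition valid_input :: "rat list \<Rightarrow> bool" where
  "valid_input I \<longleftrightarrow> (\<forall>x\<in>set I. 0 < x \<and> x \<le> 1)"

text \<open>A packing is a list of bin labels, one for each position of the input: the \<open>i\<close>-th item
  goes into bin \<open>p ! i\<close>. Labels carry no meaning; only non-empty bins are counted.\<close>

definition is_packing :: "rat list \<Rightarrow> nat list \<Rightarrow> bool" where
  "is_packing I p \<longleftrightarrow> length p = length I \<and>
     (\<forall>b. (\<Sum>i | i < length I \<and> p ! i = b. I ! i) \<le> 1)"

definition bins_used :: "nat list \<Rightarrow> nat" where
  "bins_used p = card (set p)"

definition OPT :: "rat list \<Rightarrow> nat" where
  "OPT I = (LEAST k. \<exists>p. is_packing I p \<and> bins_used p = k)"

text \<open>A deterministic online algorithm \<open>A\<close> that is told \<open>Q\<close> in advance: \<open>A Q xs\<close> is the bin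
  chosen for the last item of \<open>xs\<close>, where \<open>xs\<close> lists all items revealed so far. The earlier
  decisions need not be passed along, since they are determined by \<open>A\<close>, \<open>Q\<close> and the
  prefixes of \<open>xs\<close>.\<close>

type_synonym ko_algorithm = "nat \<Rightarrow> rat list \<Rightarrow> nat"

definition run :: "ko_algorithm \<Rightarrow> nat \<Rightarrow> rat list \<Rightarrow> nat list" where
  "run A Q I = map (\<lambda>i. A Q (take (Suc i) I)) [0..<length I]"

text \<open>The advice \<open>Q\<close> is always the true optimum of the whole input, so nothing is required of
  \<open>A\<close> when it is told a wrong value.\<close>

definition online_ko_algorithm :: "ko_algorithm \<Rightarrow> bool" where
  "online_ko_algorithm A \<longleftrightarrow> (\<forall>I. valid_input I \<longrightarrow> is_packing I (run A (OPT I) I))"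

definition alg_cost :: "ko_algorithm \<Rightarrow> rat list \<Rightarrow> nat" where
  "alg_cost A I = bins_used (run A (OPT I) I)"

text \<open>A supremum in the extended reals stands for the maximum: an algorithm may have unbounded
  cost on the inputs with a fixed optimum (arbitrarily many tiny items), and then the value is
  \<open>\<infinity>\<close>.\<close>

definition worst_cost :: "ko_algorithm \<Rightarrow> nat \<Rightarrow> ereal" where
  "worst_cost A Q = (SUP I\<in>{I. valid_input I \<and> OPT I = Q}. ereal (real (alg_cost A I)))"

definition asymptotic_ratio :: "ko_algorithm \<Rightarrow> ereal" where
  "asymptotic_ratio A = limsup (\<lambda>Q. worst_cost A Q / ereal (real Q))"

lemma ex_packing:
  assumes "valid_input I"
  shows "is_packing I [0..<length I]"
proof -
  have "(\<Sum>i | i < length I \<and> [0..<length I] ! i = b. I ! i) \<le> 1" for b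
  proof -
    have "{i. i < length I \<and> [0..<length I] ! i = b} = (if b < length I then {b} else {})"
      by auto
    then show ?thesis
      using assms by (auto simp: valid_input_def)
  qed
  then show ?thesis
    by (simp add: is_packing_def)
qed

lemma OPT_attained:
  assumes "valid_input I"
  shows "\<exists>p. is_packing I p \<and> bins_used p = OPT I"
  unfolding OPT_def by (rule LeastI_ex) (use ex_packing[OF assms] in blast)

lemma OPT_le:
  assumes "is_packing I p"
  shows "OPT I \<le> bins_used p"
  unfolding OPT_def by (rule Least_le) (use assms in blast)

end

theory Submission
  imports Defs "HOL-Library.Multiset"
begin

text \<open>The adversary announces the optimum \<open>N\<close> and issues \<open>N\<close> items slightly larger than \<open>1/7\<close>, then
  \<open>N\<close> items slightly larger than \<open>1/3\<close>. Sizes are chosen adaptively by bisection, so that in each phase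
  the items opening a new bin are exactly those above some threshold \<open>\<theta>\<close> (resp. \<open>\<eta>\<close>). Thus every bin
  of the algorithm contains an item that does not fit with an item of size \<open>1 - \<theta>\<close> (resp. \<open>1 - \<eta>\<close>),
  although an optimal packing can combine the latter with the items below the threshold. The input
  continues with items of size \<open>1 - \<theta>\<close> or \<open>5/7\<close> after the first phase, or \<open>1 - \<eta>\<close>, \<open>43/84\<close> or
  nothing after the second, and then with items of size 1 until the optimum is exactly \<open>N\<close>. A convex
  combination of the resulting costs is at least \<open>87 N / 62 - 1\<close>.\<close>

section \<open>Packings of multisets\<close>

text \<open>Groups are multisets, so the order of the items is irrelevant, and they may be empty, so
  \<open>k\<close> is only an upper bound on the bins needed. The variable capacity \<open>v\<close>
  lets partial packings be stacked before the total reaches 1.\<close>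

definition splits :: "nat \<Rightarrow> rat \<Rightarrow> rat multiset \<Rightarrow> bool" where
  "splits k v M \<longleftrightarrow> (\<exists>gs. length gs = k \<and> sum_list gs = M \<and> (\<forall>g\<in>set gs. sum_mset g \<le> v))"

lemma splits_mono:
  assumes "splits k u M" "u \<le> v"
  shows "splits k v M"
proof -
  obtain gs where "length gs = k" "sum_list gs = M" "\<forall>g\<in>set gs. sum_mset g \<le> u"
    using assms(1) by (auto simp: splits_def)
  then show ?thesis
    unfolding splits_def using assms(2) by (intro exI[of _ gs]) (auto intro: order_trans)
qed

lemma splits_add_bins:
  assumes "splits k v M" "splits l v M'"
  shows "splits (k + l) v (M + M')"
proof -
  obtain gs hs where "length gs = k" "sum_list gs = M" "\<forall>g\<in>set gs. sum_mset g \<le> v"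
    "length hs = l" "sum_list hs = M'" "\<forall>g\<in>set hs. sum_mset g \<le> v"
    using assms by (auto simp: splits_def)
  then show ?thesis
    unfolding splits_def by (intro exI[of _ "gs @ hs"]) auto
qed

text \<open>Merges the groups of both packings position by position; this is how items of different
  kinds come to share a bin.\<close>

lemma splits_add_capacity:
  assumes "splits k u M" "splits k v M'"
  shows "splits k (u + v) (M + M')"
proof -
  obtain gs hs where gs: "length gs = k" "sum_list gs = M" "\<forall>g\<in>set gs. sum_mset g \<le> u"
    and hs: "length hs = k" "sum_list hs = M'" "\<forall>g\<in>set hs. sum_mset g \<le> v"
    using assms by (auto simp: splits_def)
  have len: "length gs = length hs" using gs hs by simp
  then have "sum_list (map2 (+) gs hs) = sum_list gs + sum_list hs"
    by (induction gs hs rule: list_induct2) auto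
  moreover have "sum_mset g \<le> u + v" if "g \<in> set (map2 (+) gs hs)" for g
    using that gs(3) hs(3) by (auto dest!: set_zip_leftD set_zip_rightD intro!: add_mono
        simp: set_zip)
  ultimately show ?thesis
    unfolding splits_def using gs hs by (intro exI[of _ "map2 (+) gs hs"]) auto
qed

lemma submultiset_of_size:
  assumes "n \<le> size M"
  obtains M' where "M' \<subseteq># M" "size M' = n"
proof -
  obtain xs where xs: "mset xs = M" using ex_mset by blast
  have "mset (take n xs) \<subseteq># M"
    using xs by (metis append_take_drop_id mset_append mset_subset_eq_add_left)
  then show thesis
    using that[of "mset (take n xs)"] assms xs by auto
qed

text \<open>Greedy filling with \<open>c\<close> arbitrary items per bin works, because only the
  number of items and their common size bound matter.\<close>

lemma splits_uniform:
  assumes "size M \<le> c * k" "\<And>x. x \<in># M \<Longrightarrow> x \<le> w" "of_nat c * w \<le> v" "0 \<le> w"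
  shows "splits k v M"
  using assms(1,2)
proof (induction k arbitrary: M)
  case 0
  then show ?case by (auto simp: splits_def)
next
  case (Suc k)
  obtain g where g: "g \<subseteq># M" "size g = min c (size M)"
    using submultiset_of_size[of "min c (size M)" M] by auto
  have bound: "sum_mset G \<le> of_nat (size G) * w" if "\<forall>x\<in>#G. x \<le> w" for G :: "rat multiset"
    using that by (induction G) (auto simp: algebra_simps)
  have "sum_mset g \<le> of_nat (size g) * w"
    using Suc.prems(2) g(1) by (intro bound) (auto dest: mset_subset_eqD)
  also have "\<dots> \<le> of_nat c * w"
    using g(2) assms(4) by (intro mult_right_mono) auto
  finally have "splits 1 v g"
    using assms(3) unfolding splits_def by (intro exI[of _ "[g]"]) auto
  moreover have "splits k v (M - g)"
    using Suc.prems g by (intro Suc.IH) (auto simp: size_Diff_submset dest: in_diffD)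
  ultimately have "splits (1 + k) v (g + (M - g))"
    by (rule splits_add_bins)
  then show ?case using g(1) by simp
qed

lemma splits_replicate: "0 \<le> h \<Longrightarrow> splits k h (replicate_mset k h)"
  by (rule splits_uniform[where c = 1 and w = h]) (auto split: if_splits)

text \<open>Lets tags attached to a multiset of items be read off in the order of the input
  list.\<close>

lemma ex_list_image_mset:
  assumes "image_mset f M = mset xs"
  shows "\<exists>ys. mset ys = M \<and> map f ys = xs"
  using assms
proof (induction xs arbitrary: M)
  case Nil
  then show ?case by auto
next
  case (Cons x xs)
  then obtain N a where "M = add_mset a N" "f a = x" "image_mset f N = mset xs"
    using msed_map_invR[of f M x "mset xs"] by auto
  moreover from this Cons.IH obtain ys where "mset ys = N" "map f ys = xs" by blast
  ultimately show ?case by (intro exI[of _ "a # ys"]) auto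
qed

lemma OPT_le_splits:
  assumes "splits k 1 (mset I)"
  shows "OPT I \<le> k"
proof -
  obtain gs where gs: "length gs = k" "sum_list gs = mset I" "\<forall>g\<in>set gs. sum_mset g \<le> 1"
    using assms by (auto simp: splits_def)
  \<comment> \<open>Each item is tagged with the index of its group; listing the pairs in input
    order turns the tags into bin labels.\<close>
  define M where "M = (\<Sum>b<k. image_mset (Pair b) (gs ! b))"
  have "image_mset snd M = (\<Sum>b<k. gs ! b)"
    unfolding M_def by (induction k) (auto simp: image_mset.compositionality comp_def)
  also have "\<dots> = mset I"
    using gs(1,2) by (simp add: sum_list_sum_nth atLeast0LessThan)
  finally obtain ps where ps: "mset ps = M" "map snd ps = I"
    using ex_list_image_mset by blast
  define p where "p = map fst ps"
  have filt: "filter_mset (\<lambda>q. fst q = b) (\<Sum>b<n. image_mset (Pair b) (gs ! b)) =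
      (if b < n then image_mset (Pair b) (gs ! b) else {#})" for b n
    by (induction n) (auto simp: filter_mset_image_mset less_Suc_eq)
  have load: "(\<Sum>i | i < length I \<and> p ! i = b. I ! i) \<le> 1" for b
  proof -
    have "(\<Sum>i | i < length I \<and> p ! i = b. I ! i) = (\<Sum>i<length ps. if fst (ps ! i) = b then snd (ps ! i) else 0)"
      unfolding p_def ps(2)[symmetric]
      by (subst sum.inter_filter[symmetric]) (auto intro!: sum.cong)
    also have "\<dots> = sum_list (map (\<lambda>q. if fst q = b then snd q else 0) ps)"
      by (simp add: sum_list_sum_nth atLeast0LessThan)
    also have "\<dots> = sum_mset (image_mset (\<lambda>q. if fst q = b then snd q else 0) M)"
      by (simp add: ps(1)[symmetric] flip: sum_mset_sum_list)
    also have "\<dots> = sum_mset (image_mset snd (filter_mset (\<lambda>q. fst q = b) M))"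
      by (induction M) auto
    also have "\<dots> = (if b < k then sum_mset (gs ! b) else 0)"
      unfolding M_def filt by (simp add: image_mset.compositionality comp_def)
    also have "\<dots> \<le> 1" using gs by auto
    finally show ?thesis .
  qed
  have len: "length p = length I" using ps(2) by (auto simp: p_def)
  then have "is_packing I p" using load by (simp add: is_packing_def)
  then have "OPT I \<le> bins_used p" by (rule OPT_le)
  also have "\<dots> \<le> card {..<k}"
  proof -
    have "fst q < n" if "q \<in># (\<Sum>b<n. image_mset (Pair b) (gs ! b))" for q n
      using that by (induction n) (auto simp: less_Suc_eq)
    then have "set p \<subseteq> {..<k}"
      using ps(1) by (auto simp: p_def M_def simp flip: set_mset_mset)
    then show ?thesis unfolding bins_used_def by (intro card_mono) auto
  qed
  finally show ?thesis by simp
qed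

section \<open>Loads and closed bins\<close>

definition load :: "rat list \<Rightarrow> nat list \<Rightarrow> nat \<Rightarrow> rat" where
  "load I p b = (\<Sum>i | i < length I \<and> p ! i = b. I ! i)"

lemma valid_input_nth: "valid_input I \<Longrightarrow> i < length I \<Longrightarrow> 0 < I ! i \<and> I ! i \<le> 1"
  by (auto simp: valid_input_def)

lemma valid_input_append [simp]: "valid_input (I @ J) \<longleftrightarrow> valid_input I \<and> valid_input J"
  by (auto simp: valid_input_def)

lemma nth_le_load:
  assumes "valid_input I" "i < length I" "p ! i = b"
  shows "I ! i \<le> load I p b"
  unfolding load_def using assms
  by (intro member_le_sum) (auto dest: valid_input_nth intro: less_imp_le)

lemma load_append:
  assumes "length p = length I + length H"
  shows "load (I @ H) p b = load I (take (length I) p) b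
    + (\<Sum>j | j < length H \<and> p ! (length I + j) = b. H ! j)"
proof -
  have "{i. i < length (I @ H) \<and> p ! i = b} = {i. i < length I \<and> p ! i = b}
     \<union> (+) (length I) ` {j. j < length H \<and> p ! (length I + j) = b}" (is "_ = ?A \<union> ?B")
  proof (intro equalityI subsetI)
    fix i assume i: "i \<in> {i. i < length (I @ H) \<and> p ! i = b}"
    show "i \<in> ?A \<union> ?B"
    proof (cases "i < length I")
      case False
      then obtain j where "i = length I + j" using le_Suc_ex not_less by blast
      then show ?thesis using i by simp
    qed (use i in simp)
  qed auto
  then have "load (I @ H) p b = (\<Sum>i\<in>?A. (I @ H) ! i) + (\<Sum>i\<in>?B. (I @ H) ! i)"
    unfolding load_def by (simp only:) (rule sum.union_disjoint; auto)
  also have "(\<Sum>i\<in>?A. (I @ H) ! i) = load I (take (length I) p) b"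
    unfolding load_def by (intro sum.cong) (auto simp: nth_append)
  also have "(\<Sum>i\<in>?B. (I @ H) ! i) = (\<Sum>j | j < length H \<and> p ! (length I + j) = b. H ! j)"
    by (subst sum.reindex) (auto simp: nth_append)
  finally show ?thesis .
qed

lemma is_packing_iff_load:
  "is_packing I p \<longleftrightarrow> length p = length I \<and> (\<forall>b. load I p b \<le> 1)"
  by (simp add: is_packing_def load_def)

lemma is_packing_prefix:
  assumes "is_packing (I @ H) p" "valid_input (I @ H)"
  shows "is_packing I (take (length I) p)"
proof -
  have len: "length p = length I + length H" and le: "load (I @ H) p b \<le> 1" for b
    using assms(1) by (auto simp: is_packing_iff_load)
  have nonneg: "0 \<le> (\<Sum>j | j < length H \<and> p ! (length I + j) = b. H ! j)" for b
    using assms(2) by (intro sum_nonneg) (auto intro: less_imp_le dest: valid_input_nth)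
  have "load I (take (length I) p) b \<le> 1" for b
    using le[of b] load_append[OF len, of b] nonneg[of b] by linarith
  then show ?thesis using len by (simp add: is_packing_iff_load)
qed

lemma load_add_le_1:
  assumes "is_packing (I @ H) p" "valid_input (I @ H)" "T \<subseteq> {..<length H}"
    "\<And>j. j \<in> T \<Longrightarrow> p ! (length I + j) = b"
  shows "load I (take (length I) p) b + (\<Sum>j\<in>T. H ! j) \<le> 1"
proof -
  have len: "length p = length I + length H" and le: "load (I @ H) p b \<le> 1"
    using assms(1) by (auto simp: is_packing_iff_load)
  have "0 \<le> H ! j" if "j < length H" for j
    using assms(2) that by (auto intro: less_imp_le dest: valid_input_nth)
  then have "(\<Sum>j\<in>T. H ! j) \<le> (\<Sum>j | j < length H \<and> p ! (length I + j) = b. H ! j)"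
    using assms(3,4) by (intro sum_mono2) auto
  then show ?thesis using le load_append[OF len, of b] by linarith
qed

lemma load_nonneg: "valid_input I \<Longrightarrow> 0 \<le> load I p b"
  unfolding load_def by (intro sum_nonneg) (auto intro!: less_imp_le dest: valid_input_nth)

text \<open>Two items above 1/2 never share a bin, and none of them fits into a bin of
  \<open>D\<close>, so the bins receiving \<open>H\<close> are distinct and lie outside
  \<open>D\<close>.\<close>

lemma bins_used_ge_closed:
  assumes pk: "is_packing (I @ H) p" and val: "valid_input (I @ H)"
    and big: "\<And>h. h \<in> set H \<Longrightarrow> 1 / 2 < h"
    and D: "D \<subseteq> set (take (length I) p)"
    and closed: "\<And>b h. b \<in> D \<Longrightarrow> h \<in> set H \<Longrightarrow> 1 < load I (take (length I) p) b + h"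
  shows "card D + length H \<le> bins_used p"
proof -
  define f where "f = (\<lambda>j. p ! (length I + j))"
  have len: "length p = length I + length H" using pk by (simp add: is_packing_def)
  have "inj_on f {..<length H}"
  proof (rule inj_onI, rule ccontr)
    fix i j assume ij: "i \<in> {..<length H}" "j \<in> {..<length H}" "f i = f j" "i \<noteq> j"
    then have "load I (take (length I) p) (f i) + (\<Sum>j\<in>{i, j}. H ! j) \<le> 1"
      by (intro load_add_le_1[OF pk val]) (auto simp: f_def)
    moreover have "0 \<le> load I (take (length I) p) (f i)" using val by (simp add: load_nonneg)
    moreover have "1 / 2 < H ! i" "1 / 2 < H ! j" using ij big by auto
    ultimately show False using ij(4) by simp
  qed
  then have "length H = card (f ` {..<length H})" by (simp add: card_image)
  moreover have "D \<inter> f ` {..<length H} = {}"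
  proof (rule ccontr)
    assume "D \<inter> f ` {..<length H} \<noteq> {}"
    then obtain j where j: "j < length H" "f j \<in> D" by auto
    have "load I (take (length I) p) (f j) + (\<Sum>j\<in>{j}. H ! j) \<le> 1"
      using j by (intro load_add_le_1[OF pk val]) (auto simp: f_def)
    then show False using closed[OF j(2), of "H ! j"] j(1) by simp
  qed
  moreover have "finite D" using D finite_subset by blast
  ultimately have "card D + length H = card (D \<union> f ` {..<length H})"
    by (simp add: card_Un_disjoint)
  also have "\<dots> \<le> card (set p)"
    using D len by (intro card_mono) (auto simp: f_def dest: in_set_takeD)
  finally show ?thesis by (simp add: bins_used_def)
qed

lemma OPT_append_ones_le: "valid_input I \<Longrightarrow> OPT (I @ replicate k 1) \<le> OPT I + k"
proof (induction k)
  case (Suc k)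
  let ?J = "I @ replicate k 1"
  have val: "valid_input ?J" using Suc.prems by (auto simp: valid_input_def)
  obtain p where p: "is_packing ?J p" "bins_used p = OPT ?J"
    using OPT_attained[OF val] by auto
  obtain c where c: "c \<notin> set p" by (meson finite_set infinite_UNIV_nat ex_new_if_finite)
  have len: "length p = length ?J" using p(1) by (simp add: is_packing_def)
  have "load (?J @ [1]) (p @ [c]) b \<le> 1" for b
  proof -
    have "{j. j < length [1 :: rat] \<and> (p @ [c]) ! (length ?J + j) = b} = (if c = b then {0} else {})"
      using len by (auto simp: nth_append)
    then have "load (?J @ [1]) (p @ [c]) b = load ?J p b + (if c = b then 1 else 0)"
      using len by (subst load_append) auto
    moreover have "load ?J p c = 0"
      using c len unfolding load_def by (intro sum.neutral) (auto dest: nth_mem)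
    moreover have "load ?J p b \<le> 1" using p(1) by (simp add: is_packing_iff_load)
    ultimately show ?thesis by (cases "c = b") auto
  qed
  then have "is_packing (?J @ [1]) (p @ [c])" using len by (simp add: is_packing_iff_load)
  then have "OPT (?J @ [1]) \<le> bins_used (p @ [c])" by (rule OPT_le)
  also have "\<dots> = OPT ?J + 1" using c p(2) by (simp add: bins_used_def)
  also have "\<dots> \<le> OPT I + Suc k" using Suc by simp
  finally show ?case by (simp add: replicate_append_same)
qed simp

lemma load_pos:
  assumes "valid_input I" "b \<in> set p" "length p = length I"
  shows "0 < load I p b"
proof -
  obtain i where i: "i < length p" "p ! i = b" using assms(2) by (auto simp: in_set_conv_nth)
  then have "I ! i \<le> load I p b" using assms by (intro nth_le_load) auto
  then show ?thesis using valid_input_nth[OF assms(1), of i] i assms(3) by auto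
qed

text \<open>For the lower bound, every bin holding an item of \<open>I\<close> has positive load and
  is thus closed for items of size 1.\<close>

lemma OPT_append_ones:
  assumes val: "valid_input I"
  shows "OPT (I @ replicate k 1) = OPT I + k"
proof (rule antisym)
  let ?J = "I @ replicate k (1 :: rat)"
  have valJ: "valid_input ?J" using val by (auto simp: valid_input_def)
  obtain p where p: "is_packing ?J p" "bins_used p = OPT ?J"
    using OPT_attained[OF valJ] by auto
  let ?q = "take (length I) p"
  have len: "length p = length ?J" using p(1) by (simp add: is_packing_def)
  have "OPT I \<le> bins_used ?q" by (rule OPT_le[OF is_packing_prefix[OF p(1) valJ]])
  moreover have "card (set ?q) + length (replicate k (1 :: rat)) \<le> bins_used p"
    using load_pos[OF val, of _ ?q] len by (intro bins_used_ge_closed[OF p(1) valJ]) auto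
  ultimately show "OPT I + k \<le> OPT ?J" using p(2) by (simp add: bins_used_def)
qed (rule OPT_append_ones_le[OF val])

section \<open>Forcing an online algorithm\<close>

lemma length_run [simp]: "length (run A Q I) = length I"
  by (simp add: run_def)

lemma nth_run: "i < length I \<Longrightarrow> run A Q I ! i = A Q (take (Suc i) I)"
  by (simp add: run_def)

text \<open>The online property: for a fixed announced value, decisions on \<open>I\<close> do not
  depend on the continuation.\<close>

lemma take_run_append: "take (length I) (run A Q (I @ J)) = run A Q I"
  by (rule nth_equalityI) (auto simp: nth_run)

lemma take_run: "take n (run A Q I) = run A Q (take n I)"
  using take_run_append[of "take n I" A Q "drop n I"] by (cases "n \<le> length I") auto

text \<open>Items of size 1 close up the gap between the optimum and the announced value; each of them
  costs the algorithm a new bin.\<close>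

lemma forced_cost:
  assumes on: "online_ko_algorithm A"
    and val: "valid_input (I @ H)" and k: "splits k 1 (mset (I @ H))" "k \<le> Q"
    and big: "\<And>h. h \<in> set H \<Longrightarrow> 1 / 2 < h"
    and D: "D \<subseteq> set (run A Q I)"
    and closed: "\<And>b h. b \<in> D \<Longrightarrow> h \<in> set H \<Longrightarrow> 1 < load I (run A Q I) b + h"
  shows "\<exists>J. valid_input (I @ J) \<and> OPT (I @ J) = Q
    \<and> card D + length H + Q \<le> alg_cost A (I @ J) + k"
proof -
  \<comment> \<open>The padding uses the true optimum, since \<open>k\<close> only bounds it from
    above; hence there are at least \<open>Q - k\<close> ones.\<close>
  define l where "l = Q - OPT (I @ H)"
  define J where "J = H @ replicate l 1"
  have opt: "OPT (I @ H) \<le> k" using k(1) by (rule OPT_le_splits)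
  have val': "valid_input (I @ J)" using val by (auto simp: J_def valid_input_def)
  have Q: "OPT (I @ J) = Q"
    using OPT_append_ones[OF val, of l] opt k(2) by (simp add: J_def l_def)
  have pk: "is_packing (I @ J) (run A Q (I @ J))"
    using on val' Q by (auto simp: online_ko_algorithm_def)
  have "card D + length J \<le> bins_used (run A Q (I @ J))"
  proof (rule bins_used_ge_closed[OF pk val'])
    fix b h assume bh: "b \<in> D" "h \<in> set J"
    have "0 < load I (run A Q I) b" using val bh(1) D by (intro load_pos) auto
    then show "1 < load I (take (length I) (run A Q (I @ J))) b + h"
      using closed[OF bh(1), of h] bh(2) by (auto simp: take_run_append J_def)
  qed (use D big in \<open>auto simp: J_def take_run_append\<close>)
  then have "card D + length H + Q \<le> alg_cost A (I @ J) + k"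
    using opt k(2) Q by (simp add: alg_cost_def J_def l_def)
  then show ?thesis using val' Q by blast
qed

text \<open>Bisection: a large item lowers the upper end of the remaining interval, a small one raises
  its lower end.\<close>

lemma adaptive_items:
  fixes lo hi :: rat and large :: "rat list \<Rightarrow> bool"
  assumes "lo < hi"
  obtains xs \<theta> where "length xs = n" "lo \<le> \<theta>" "\<theta> < hi"
    "\<And>i. i < n \<Longrightarrow> lo < xs ! i \<and> xs ! i < hi"
    "\<And>i. i < n \<Longrightarrow> \<theta> < xs ! i \<longleftrightarrow> large (take (Suc i) xs)"
proof -
  \<comment> \<open>Invariant: large items are at or above \<open>u\<close>, small ones at or below
    \<open>l\<close>, and the next item is the midpoint. In the end \<open>\<theta> = l\<close>
    separates them.\<close>
  have "\<exists>xs l u. length xs = n \<and> lo \<le> l \<and> l < u \<and> u \<le> hi \<and>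
    (\<forall>i<n. lo < xs ! i \<and> xs ! i < hi
       \<and> (if large (take (Suc i) xs) then u \<le> xs ! i else xs ! i \<le> l))"
  proof (induction n)
    case 0
    then show ?case using assms by auto
  next
    case (Suc n)
    then obtain xs l u where IH: "length xs = n" "lo \<le> l" "l < u" "u \<le> hi"
      "\<And>i. i < n \<Longrightarrow> lo < xs ! i \<and> xs ! i < hi
         \<and> (if large (take (Suc i) xs) then u \<le> xs ! i else xs ! i \<le> l)" by auto
    define x where "x = (l + u) / 2"
    have x: "l < x" "x < u" using IH(3) by (auto simp: x_def)
    define ys where "ys = xs @ [x]"
    have ys: "take (Suc i) ys = take (Suc i) xs" "ys ! i = xs ! i" if "i < n" for i
      using that IH(1) by (auto simp: ys_def nth_append)
    have yn: "ys ! n = x" "length ys = Suc n" using IH(1) by (auto simp: ys_def nth_append)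
    \<comment> \<open>The class of \<open>x\<close> may depend on \<open>x\<close> itself, because
      the interval is narrowed only after \<open>x\<close> is fixed.\<close>
    show ?case
    proof (cases "large ys")
      case True
      have "(lo < ys ! i \<and> ys ! i < hi
         \<and> (if large (take (Suc i) ys) then x \<le> ys ! i else ys ! i \<le> l))" if "i < Suc n" for i
        using that IH(2,4) IH(5)[of i] x True yn ys[of i]
        by (cases "i = n") (auto split: if_splits)
      then show ?thesis using IH(2,4) x yn by (intro exI[of _ ys] exI[of _ l] exI[of _ x]) auto
    next
      case False
      have "(lo < ys ! i \<and> ys ! i < hi
         \<and> (if large (take (Suc i) ys) then u \<le> ys ! i else ys ! i \<le> x))" if "i < Suc n" for i
        using that IH(2,4) IH(5)[of i] x False yn ys[of i]
        by (cases "i = n") (auto split: if_splits)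
      then show ?thesis using IH(2,4) x yn by (intro exI[of _ ys] exI[of _ x] exI[of _ u]) auto
    qed
  qed
  then obtain xs l u where *: "length xs = n" "lo \<le> l" "l < u" "u \<le> hi"
    "\<And>i. i < n \<Longrightarrow> lo < xs ! i \<and> xs ! i < hi
       \<and> (if large (take (Suc i) xs) then u \<le> xs ! i else xs ! i \<le> l)" by auto
  show thesis
  proof (rule that[of xs l])
    show "l < xs ! i \<longleftrightarrow> large (take (Suc i) xs)" if "i < n" for i
      using *(3) *(5)[OF that] by (auto split: if_splits)
  qed (use * in auto)
qed

lemma card_first_occurrences: "card {i. i < length p \<and> p ! i \<notin> set (take i p)} = card (set p)"
proof (induction p rule: rev_induct)
  case (snoc x p)
  have "{i. i < length (p @ [x]) \<and> (p @ [x]) ! i \<notin> set (take i (p @ [x]))} =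
    {i. i < length p \<and> p ! i \<notin> set (take i p)} \<union> (if x \<in> set p then {} else {length p})"
    by (auto simp: nth_append less_Suc_eq split: if_splits)
  then show ?case using snoc by (auto simp: insert_absorb)
qed simp

lemma first_occurrence:
  assumes "b \<in> set p"
  obtains i where "i < length p" "p ! i = b" "b \<notin> set (take i p)"
proof -
  define i where "i = (LEAST i. i < length p \<and> p ! i = b)"
  have i: "i < length p \<and> p ! i = b"
    unfolding i_def by (rule LeastI_ex) (use assms in \<open>auto simp: in_set_conv_nth\<close>)
  moreover have "b \<notin> set (take i p)"
  proof
    assume "b \<in> set (take i p)"
    then obtain j where "j < i" "p ! j = b" "j < length p"
      by (auto simp: in_set_conv_nth)
    then show False using not_less_Least[of j "\<lambda>i. i < length p \<and> p ! i = b"] by (auto simp: i_def)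
  qed
  ultimately show thesis using that by blast
qed

text \<open>Bisection where an item is large if it opens a bin. Large items then correspond to new
  bins, which gives both the count and an item above \<open>\<theta>\<close> in each new
  bin.\<close>

lemma adaptive_items_opening:
  fixes lo hi :: rat
  assumes "lo < hi"
  obtains ys \<theta> where "length ys = n" "lo \<le> \<theta>" "\<theta> < hi"
    "\<And>y. y \<in> set ys \<Longrightarrow> lo < y \<and> y < hi"
    "size {#y \<in># mset ys. y \<le> \<theta>#} + card (set (run A Q (I @ ys))) = n + card (set (run A Q I))"
    "\<And>b. b \<in> set (run A Q (I @ ys)) \<Longrightarrow> b \<notin> set (run A Q I) \<Longrightarrow>
       \<exists>i<n. run A Q (I @ ys) ! (length I + i) = b \<and> \<theta> < ys ! i"
proof -
  define large where "large = (\<lambda>zs. A Q (I @ zs) \<notin> set (run A Q (I @ butlast zs)))"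
  obtain ys \<theta> where ys: "length ys = n" "lo \<le> \<theta>" "\<theta> < hi"
    "\<And>i. i < n \<Longrightarrow> lo < ys ! i \<and> ys ! i < hi"
    "\<And>i. i < n \<Longrightarrow> \<theta> < ys ! i \<longleftrightarrow> large (take (Suc i) ys)"
    using adaptive_items[OF assms, of n large] by blast
  define P where "P = run A Q (I @ ys)"
  let ?m = "length I"
  have lenP: "length P = ?m + n" using ys(1) by (simp add: P_def)
  have first: "\<theta> < ys ! i \<longleftrightarrow> P ! (?m + i) \<notin> set (take (?m + i) P)" if "i < n" for i
    using ys(5)[OF that] that ys(1)
    by (simp add: large_def P_def nth_run take_run butlast_take)
  have "{k. k < length P \<and> P ! k \<notin> set (take k P)} =
      {k. k < ?m \<and> P ! k \<notin> set (take k P)} \<union> (+) ?m ` {i. i < n \<and> \<theta> < ys ! i}"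
    (is "_ = ?A \<union> ?B")
  proof (intro equalityI subsetI)
    fix k assume k: "k \<in> {k. k < length P \<and> P ! k \<notin> set (take k P)}"
    show "k \<in> ?A \<union> ?B"
    proof (cases "k < ?m")
      case False
      then obtain i where "k = ?m + i" using le_Suc_ex not_less by blast
      then show ?thesis using k lenP first[of i] by simp
    qed (use k in simp)
  qed (use lenP first in auto)
  then have "card (set P) = card (?A \<union> ?B)" using card_first_occurrences[of P] by simp
  also have "\<dots> = card ?A + card ?B" by (rule card_Un_disjoint) auto
  also have "?A = {k. k < length (take ?m P) \<and> take ?m P ! k \<notin> set (take k (take ?m P))}"
    using lenP by (auto simp: min_def)
  also have "card \<dots> = card (set (run A Q I))"
    by (subst card_first_occurrences) (simp add: P_def take_run_append)
  also have "card ?B = size {#y \<in># mset ys. \<not> y \<le> \<theta>#}"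
    using ys(1) by (simp add: card_image length_filter_conv_card not_le flip: mset_filter)
  finally have "card (set P) = card (set (run A Q I)) + size {#y \<in># mset ys. \<not> y \<le> \<theta>#}" .
  moreover have "size (mset ys) = size {#y \<in># mset ys. y \<le> \<theta>#} + size {#y \<in># mset ys. \<not> y \<le> \<theta>#}"
    by (metis multiset_partition size_union)
  ultimately have "size {#y \<in># mset ys. y \<le> \<theta>#} + card (set P) = n + card (set (run A Q I))"
    using ys(1) by simp
  moreover have "\<exists>i<n. P ! (?m + i) = b \<and> \<theta> < ys ! i" if b: "b \<in> set P" "b \<notin> set (run A Q I)" for b
  proof -
    obtain k where k: "k < length P" "P ! k = b" "b \<notin> set (take k P)"
      using first_occurrence[OF b(1)] .
    have "\<not> k < ?m"
    proof
      assume "k < ?m"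
      then have "b \<in> set (take ?m P)" using k(1,2) lenP by (auto simp: in_set_conv_nth)
      then show False using b(2) by (simp add: P_def take_run_append)
    qed
    then obtain i where "k = ?m + i" using le_Suc_ex not_less by blast
    then show ?thesis using k lenP first[of i] by auto
  qed
  ultimately show thesis
    using ys(1-4) by (intro that[of ys \<theta>]) (auto simp: P_def in_set_conv_nth)
qed

section \<open>Item counts, loads and weights of bins\<close>

lemma load_ge_count:
  assumes "length p = length I" "\<And>x. x \<in> set I \<Longrightarrow> v < x"
  shows "of_nat (count_list p b) * v \<le> load I p b"
    and "b \<in> set p \<Longrightarrow> of_nat (count_list p b) * v < load I p b"
proof -
  let ?S = "{i. i < length I \<and> p ! i = b}"
  have eq: "of_nat (count_list p b) * v = (\<Sum>i\<in>?S. v)"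
    using assms(1) by (simp add: count_list_eq_length_filter length_filter_conv_card eq_commute)
  show "of_nat (count_list p b) * v \<le> load I p b"
    unfolding eq load_def using assms by (intro sum_mono) (auto intro: less_imp_le)
  show "of_nat (count_list p b) * v < load I p b" if "b \<in> set p"
    unfolding eq load_def using assms that
    by (intro sum_strict_mono) (auto simp: in_set_conv_nth)
qed

lemma load_append_gt:
  assumes len: "length P = length xs + length ys"
    and xs: "\<And>x. x \<in> set xs \<Longrightarrow> v < x" and ys: "\<And>y. y \<in> set ys \<Longrightarrow> w < y" and b: "b \<in> set P"
  shows "of_nat (count_list (take (length xs) P) b) * v + of_nat (count_list (drop (length xs) P) b) * w
    < load (xs @ ys) P b"
proof -
  let ?p = "take (length xs) P" and ?q = "drop (length xs) P"
  have "load (xs @ ys) P b = load xs ?p b + load ys ?q b"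
    using len by (simp add: load_append) (simp add: load_def)
  moreover have "b \<in> set ?p \<or> b \<in> set ?q"
    using b by (metis Un_iff append_take_drop_id set_append)
  moreover have lens: "length ?p = length xs" "length ?q = length ys" using len by auto
  note load_ge_count[OF lens(1) xs, of b] load_ge_count[OF lens(2) ys, of b]
  ultimately show ?thesis by (metis add_le_less_mono add_less_le_mono)
qed

text \<open>The weights come from the dual of the linear program that minimizes the competitive ratio over
  the distribution of bin types; \<open>i\<close> and \<open>j\<close> count the items from the two phases in a bin.\<close>

lemma weight_many_small:
  fixes i j :: nat
  assumes "3 * i + 7 * j < 21" "i + j \<noteq> 0"
  shows "5 * i + 10 * j \<le> 5 * of_bool (1 \<le> i) + 5 * of_bool (2 \<le> i)
    + 10 * of_bool (3 \<le> i \<or> 1 \<le> j) + 10 * of_bool (4 \<le> i \<or> 2 \<le> j \<or> 2 \<le> i \<and> 1 \<le> j)"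
proof -
  \<comment> \<open>The hypothesis is \<open>i / 7 + j / 3 < 1\<close> cleared of denominators; only
    finitely many bin types remain.\<close>
  have "j = 0 \<or> j = 1 \<or> j = 2" using assms(1) by linarith
  then show ?thesis using assms by (elim disjE) (auto simp: of_bool_def)
qed

text \<open>For the case that fewer than half of the second-phase items are small. The term
  \<open>of_bool (i = 0)\<close> marks bins opened in the second phase, which are as many as its
  large items; the final 1 counts all bins, for the continuation that stops there.\<close>

lemma weight_few_small:
  fixes i j :: nat
  assumes "3 * i + 7 * j < 21" "i + j \<noteq> 0"
  shows "i + 2 * j + of_bool (i = 0) \<le> of_bool (2 \<le> i) + 2 * of_bool (3 \<le> i \<or> 1 \<le> j)
    + 2 * of_bool (4 \<le> i \<or> 2 \<le> j \<or> 2 \<le> i \<and> 1 \<le> j) + 1"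
proof -
  have "j = 0 \<or> j = 1 \<or> j = 2" using assms(1) by linarith
  then show ?thesis using assms by (elim disjE) (auto simp: of_bool_def)
qed

section \<open>The adversary\<close>

text \<open>Every continuation with optimum \<open>N\<close> yields a lower bound on
  \<open>C\<close>; these bounds are finally combined.\<close>

locale bounded_ko =
  fixes A :: ko_algorithm and N :: nat and C :: real
  assumes online: "online_ko_algorithm A"
    and bound: "\<And>J. valid_input J \<Longrightarrow> OPT J = N \<Longrightarrow> real (alg_cost A J) \<le> C"
begin

lemma cost_bound:
  assumes "valid_input (I @ H)" "splits k 1 (mset (I @ H))" "k \<le> N"
    "\<And>h. h \<in> set H \<Longrightarrow> 1 / 2 < h" "D \<subseteq> set (run A N I)"
    "\<And>b h. b \<in> D \<Longrightarrow> h \<in> set H \<Longrightarrow> 1 < load I (run A N I) b + h"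
  shows "real (card D) + real (length H) + real N \<le> C + real k"
proof -
  obtain J where "valid_input (I @ J)" "OPT (I @ J) = N"
    "card D + length H + N \<le> alg_cost A (I @ J) + k"
    using forced_cost[OF online assms] by blast
  then show ?thesis using bound[of "I @ J"] by linarith
qed

text \<open>The algorithm is only known to be correct when told the true optimum, so
  \<open>I\<close> is first padded with ones to optimum \<open>N\<close>.\<close>

lemma run_is_packing:
  assumes "valid_input I" "splits k 1 (mset I)" "k \<le> N"
  shows "is_packing I (run A N I)"
proof -
  have "OPT I \<le> N" using OPT_le_splits[OF assms(2)] assms(3) by simp
  then have "OPT (I @ replicate (N - OPT I) 1) = N" (is "OPT (I @ ?H) = N")
    using OPT_append_ones[OF assms(1)] by simp
  moreover have val: "valid_input (I @ ?H)" using assms(1) by (auto simp: valid_input_def)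
  ultimately have "is_packing (I @ ?H) (run A N (I @ ?H))"
    using online by (metis online_ko_algorithm_def)
  from is_packing_prefix[OF this val] show ?thesis by (simp add: take_run_append)
qed

end

text \<open>The upper ends are \<open>1 / 7 + 1 / 168\<close> and \<open>1 / 3 + 1 / 168\<close>:
  small enough for six items of the first phase, or two of each phase, to share a bin. Divisibility
  of \<open>N\<close> by 4 makes the optima \<open>N / 2\<close> and the cutoff \<open>2 * q\<close>
  exact.\<close>

locale two_phases = bounded_ko +
  fixes q :: nat and xs ys :: "rat list" and \<theta> \<eta> :: rat
  assumes N: "N = 4 * q"
    and len: "length xs = N" "length ys = N"
    and \<theta>: "1 / 7 \<le> \<theta>" "\<theta> < 25 / 168" and \<eta>: "1 / 3 \<le> \<eta>" "\<eta> < 57 / 168"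
    and xs: "\<And>x. x \<in> set xs \<Longrightarrow> 1 / 7 < x \<and> x < 25 / 168"
    and ys: "\<And>y. y \<in> set ys \<Longrightarrow> 1 / 3 < y \<and> y < 57 / 168"
    and small_xs: "size {#x \<in># mset xs. x \<le> \<theta>#} + card (set (run A N xs)) = N"
    and small_ys: "size {#y \<in># mset ys. y \<le> \<eta>#} + card (set (run A N (xs @ ys)))
      = N + card (set (run A N xs))"
    and opening_xs: "\<And>b. b \<in> set (run A N xs) \<Longrightarrow> \<exists>i<N. run A N xs ! i = b \<and> \<theta> < xs ! i"
    and opening_ys: "\<And>b. b \<in> set (run A N (xs @ ys)) \<Longrightarrow> b \<notin> set (run A N xs) \<Longrightarrow>
      \<exists>i<N. run A N (xs @ ys) ! (N + i) = b \<and> \<eta> < ys ! i"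
begin

section \<open>Bin types: numbers of items from each phase\<close>

abbreviation "B1 \<equiv> set (run A N xs)"
abbreviation "B2 \<equiv> set (run A N (xs @ ys))"

definition c1 :: "nat \<Rightarrow> nat" where "c1 b = count_list (run A N xs) b"
definition c2 :: "nat \<Rightarrow> nat" where "c2 b = count_list (drop N (run A N (xs @ ys))) b"

lemma B1_subset: "B1 \<subseteq> B2"
  using take_run_append[of xs A N ys] by (metis set_take_subset)

lemma in_B1_iff: "b \<in> B1 \<longleftrightarrow> 1 \<le> c1 b"
  using count_list_0_iff[of "run A N xs" b] by (auto simp: c1_def Suc_le_eq)

lemma sum_c1: "(\<Sum>b\<in>B2. c1 b) = N"
  unfolding c1_def using B1_subset len by (subst sum_count_set) auto

lemma sum_c2: "(\<Sum>b\<in>B2. c2 b) = N"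
  unfolding c2_def using len by (subst sum_count_set) (auto dest: in_set_dropD)

lemma valid_xs: "valid_input xs" and valid_ys: "valid_input ys"
  using xs ys by (fastforce simp: valid_input_def)+

lemma load_phase1: "b \<in> B1 \<Longrightarrow> of_nat (c1 b) / 7 < load xs (run A N xs) b"
  using load_ge_count(2)[of "run A N xs" xs "1/7" b] xs by (simp add: c1_def)

lemma load_phase2:
  "b \<in> B2 \<Longrightarrow> of_nat (c1 b) / 7 + of_nat (c2 b) / 3 < load (xs @ ys) (run A N (xs @ ys)) b"
  using load_append_gt[of "run A N (xs @ ys)" xs ys "1/7" "1/3" b] xs ys len
    take_run_append[of xs A N ys]
  by (simp add: c1_def c2_def)

text \<open>Pair \<open>s\<close> items of the second phase with items of size \<open>1 - \<eta>\<close>, and put \<open>s\<close> items of the first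
  phase, two by two, with further such items. The remaining bins take two items from each phase.\<close>

lemma splits_rest:
  assumes s: "s \<le> size {#y \<in># mset ys. y \<le> \<eta>#}"
  shows "splits (s + (s + 1) div 2 + (N - s + 1) div 2) 1
    (mset (xs @ ys @ replicate (s + (s + 1) div 2) (1 - \<eta>)))"
proof -
  let ?t = "(s + 1) div 2" and ?u = "(N - s + 1) div 2"
  obtain M where M: "M \<subseteq># {#y \<in># mset ys. y \<le> \<eta>#}" "size M = s"
    using submultiset_of_size[OF s] by blast
  have "M \<subseteq># mset ys" using M(1) multiset_filter_subset subset_mset.order_trans by blast
  then obtain R where R: "mset ys = M + R" by (metis mset_subset_eq_exists_conv)
  have pairs: "splits n (50 / 168) (mset zs)" if "set zs \<subseteq> set xs" "length zs \<le> 2 * n" for n zs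
  proof (rule splits_uniform[where c = 2 and w = "25 / 168"])
    show "x \<le> 25 / 168" if "x \<in># mset zs" for x
      using xs[of x] that \<open>set zs \<subseteq> set xs\<close> by auto
  qed (use that in auto)
  have a: "splits s (\<eta> + (1 - \<eta>)) (M + replicate_mset s (1 - \<eta>))"
  proof (intro splits_add_capacity splits_replicate)
    show "splits s \<eta> M"
      using M \<eta> by (intro splits_uniform[where c = 1 and w = \<eta>]) (auto dest: mset_subset_eqD)
  qed (use \<eta> in simp)
  \<comment> \<open>Two first-phase items take at most \<open>50 / 168\<close>, which is below
    \<open>1 / 3 \<le> \<eta>\<close>.\<close>
  have b: "splits ?t (50 / 168 + (1 - \<eta>)) (mset (take s xs) + replicate_mset ?t (1 - \<eta>))"
  proof (intro splits_add_capacity splits_replicate)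
    show "splits ?t (50 / 168) (mset (take s xs))"
      by (rule pairs) (auto dest: in_set_takeD)
  qed (use \<eta> in simp)
  have c: "splits ?u (50 / 168 + 114 / 168) (mset (drop s xs) + R)"
  proof (rule splits_add_capacity)
    show "splits ?u (50 / 168) (mset (drop s xs))"
      by (rule pairs) (auto simp: len dest: in_set_dropD)
    have "size R = N - s" using arg_cong[OF R, of size] M(2) len by simp
    moreover have "y \<le> 57 / 168" if "y \<in># R" for y
      using that ys[of y] R by (metis less_imp_le set_mset_mset union_iff)
    ultimately show "splits ?u (114 / 168) R"
      by (intro splits_uniform[where c = 2 and w = "57 / 168"]) auto
  qed
  have "mset xs = mset (take s xs) + mset (drop s xs)"
    by (metis append_take_drop_id mset_append)
  then have "mset (xs @ ys @ replicate (s + ?t) (1 - \<eta>)) = (M + replicate_mset s (1 - \<eta>))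
      + (mset (take s xs) + replicate_mset ?t (1 - \<eta>))
      + (mset (drop s xs) + R)"
    by (simp only: replicate_add mset_append mset_replicate R ac_simps)
  moreover have "splits (s + ?t + ?u) 1 ((M + replicate_mset s (1 - \<eta>))
      + (mset (take s xs) + replicate_mset ?t (1 - \<eta>))
      + (mset (drop s xs) + R))"
    by (intro splits_add_bins splits_mono[OF a] splits_mono[OF b] splits_mono[OF c]) (use \<eta> in auto)
  ultimately show ?thesis by (simp only:)
qed

text \<open>All bins are closed for \<open>1 - \<theta>\<close>. Optimally, the small items are
  paired with these items, and the \<open>card B1\<close> large ones are packed six to a
  bin.\<close>

lemma cost_large_after_xs: "6 * real N + 5 * real (card B1) \<le> 6 * C + 5"
proof -
  let ?X = "card B1" and ?M = "{#x \<in># mset xs. x \<le> \<theta>#}" and ?L = "{#x \<in># mset xs. \<not> x \<le> \<theta>#}"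
  define k where "k = (?X + 5) div 6"
  have parts: "mset xs = ?M + ?L" by (rule multiset_partition)
  from arg_cong[OF this, of size] have "length xs = size ?M + size ?L"
    by (simp only: size_mset size_union)
  then have sizes: "size ?M = N - ?X" "size ?L = ?X" "?X \<le> N" using small_xs len by auto
  have "splits (N - ?X) (\<theta> + (1 - \<theta>)) (?M + replicate_mset (N - ?X) (1 - \<theta>))"
  proof (intro splits_add_capacity splits_replicate)
    show "splits (N - ?X) \<theta> ?M"
      using sizes \<theta> by (intro splits_uniform[where c = 1 and w = \<theta>]) auto
  qed (use \<theta> in simp)
  moreover have "splits k 1 ?L"
    using sizes xs by (intro splits_uniform[where c = 6 and w = "25 / 168"])
      (auto simp: k_def intro: less_imp_le)
  ultimately have "splits (N - ?X + k) 1 ((?M + replicate_mset (N - ?X) (1 - \<theta>)) + ?L)"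
    by (intro splits_add_bins) auto
  moreover have "mset (xs @ replicate (N - ?X) (1 - \<theta>)) = (?M + replicate_mset (N - ?X) (1 - \<theta>)) + ?L"
    unfolding mset_append mset_replicate by (subst parts) (simp only: ac_simps)
  ultimately have sp: "splits (N - ?X + k) 1 (mset (xs @ replicate (N - ?X) (1 - \<theta>)))"
    by (simp only:)
  have "k \<le> ?X" by (simp add: k_def)
  have "real ?X + real (length (replicate (N - ?X) (1 - \<theta>))) + real N \<le> C + real (N - ?X + k)"
  proof (rule cost_bound[OF _ sp])
    fix b h assume "b \<in> B1" "h \<in> set (replicate (N - ?X) (1 - \<theta>))"
    moreover obtain i where "i < N" "run A N xs ! i = b" "\<theta> < xs ! i"
      using opening_xs[OF \<open>b \<in> B1\<close>] by blast
    moreover from this have "xs ! i \<le> load xs (run A N xs) b"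
      using valid_xs len by (intro nth_le_load) auto
    ultimately show "1 < load xs (run A N xs) b + h" by simp
  qed (use \<theta> valid_xs sizes \<open>k \<le> ?X\<close> in \<open>auto simp: valid_input_def\<close>)
  then have "real N + real ?X \<le> C + real k" using sizes by (simp add: of_nat_diff)
  moreover have "6 * k \<le> ?X + 5" by (simp add: k_def)
  ultimately show ?thesis by linarith
qed

text \<open>An item of size 5/7 fits with one first-phase item but not with two.\<close>

lemma cost_medium_after_xs: "real N + real (card {b \<in> B2. 2 \<le> c1 b}) \<le> C"
proof -
  let ?D = "{b \<in> B2. 2 \<le> c1 b}" and ?H = "replicate N (5 / 7 :: rat)"
  have "splits N (2 / 7 + 5 / 7) (mset xs + replicate_mset N (5 / 7))"
  proof (intro splits_add_capacity splits_replicate)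
    show "splits N (2 / 7) (mset xs)"
      using xs len by (intro splits_uniform[where c = 1 and w = "25 / 168"]) (auto intro: less_imp_le)
  qed simp
  then have sp: "splits N 1 (mset (xs @ ?H))" by simp
  have "real (card ?D) + real (length ?H) + real N \<le> C + real N"
  proof (rule cost_bound[OF _ sp])
    show "?D \<subseteq> B1" by (auto simp: in_B1_iff)
    fix b h assume bh: "b \<in> ?D" "h \<in> set ?H"
    then have "of_nat (c1 b) / 7 < load xs (run A N xs) b"
      by (intro load_phase1) (simp add: in_B1_iff)
    moreover have "of_nat 2 \<le> (of_nat (c1 b) :: rat)"
      unfolding of_nat_le_iff using bh(1) by simp
    ultimately show "1 < load xs (run A N xs) b + h" using bh(2) by simp
  qed (use valid_xs in \<open>auto simp: valid_input_def\<close>)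
  then show ?thesis by simp
qed

text \<open>The bins counted have load above \<open>\<eta>\<close>: those opened in the second phase
  by their opening item, the others by their item counts.\<close>

lemma cost_large_after_ys:
  assumes s: "s \<le> size {#y \<in># mset ys. y \<le> \<eta>#}" "s \<le> 2 * q"
  shows "real (card {b \<in> B2. 3 \<le> c1 b \<or> 1 \<le> c2 b}) + real N \<le> C + real ((N - s + 1) div 2)"
proof -
  let ?D = "{b \<in> B2. 3 \<le> c1 b \<or> 1 \<le> c2 b}" and ?H = "replicate (s + (s + 1) div 2) (1 - \<eta>)"
  have sp: "splits (s + (s + 1) div 2 + (N - s + 1) div 2) 1 (mset ((xs @ ys) @ ?H))"
    using splits_rest[OF s(1)] by simp
  have "real (card ?D) + real (length ?H) + real N
      \<le> C + real (s + (s + 1) div 2 + (N - s + 1) div 2)"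
  proof (rule cost_bound[OF _ sp])
    \<comment> \<open>For odd \<open>s\<close>, rounding costs one extra bin; this is harmless
      because then \<open>s < 2 * q\<close>.\<close>
    show "s + (s + 1) div 2 + (N - s + 1) div 2 \<le> N"
      using s(2) by (cases "s = 2 * q") (auto simp: N)
    fix b h assume bh: "b \<in> ?D" "h \<in> set ?H"
    have h: "h = 1 - \<eta>" using bh(2) by (simp split: if_splits)
    have "\<eta> < load (xs @ ys) (run A N (xs @ ys)) b"
    proof (cases "b \<in> B1")
      case False
      then obtain i where i: "i < N" "run A N (xs @ ys) ! (N + i) = b" "\<eta> < ys ! i"
        using opening_ys[of b] bh(1) by auto
      have "(xs @ ys) ! (N + i) \<le> load (xs @ ys) (run A N (xs @ ys)) b"
        using valid_xs valid_ys i len by (intro nth_le_load) auto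
      then show ?thesis using i len by (simp add: nth_append)
    next
      case True
      then have "3 \<le> c1 b \<or> 1 \<le> c1 b \<and> 1 \<le> c2 b" using bh(1) by (auto simp: in_B1_iff)
      \<comment> \<open>A load above \<open>9 / 21 = 72 / 168\<close> exceeds
        \<open>\<eta>\<close>.\<close>
      then have "9 \<le> 3 * c1 b + 7 * c2 b" by linarith
      then have "of_nat 9 \<le> (of_nat (3 * c1 b + 7 * c2 b) :: rat)" by (simp only: of_nat_le_iff)
      then show ?thesis using load_phase2[of b] bh(1) \<eta> by simp
    qed
    then show "1 < load (xs @ ys) (run A N (xs @ ys)) b + h" using h by simp
  qed (use valid_xs valid_ys \<eta> in \<open>auto simp: valid_input_def split: if_splits\<close>)
  then show ?thesis by simp
qed

text \<open>Here \<open>43 / 84\<close> is exactly what the largest sizes of both phases leave free,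
  while the bins counted have load above \<open>12 / 21\<close>.\<close>

lemma cost_medium_after_ys:
  "real N + real (card {b \<in> B2. 4 \<le> c1 b \<or> 2 \<le> c2 b \<or> 2 \<le> c1 b \<and> 1 \<le> c2 b}) \<le> C"
proof -
  let ?D = "{b \<in> B2. 4 \<le> c1 b \<or> 2 \<le> c2 b \<or> 2 \<le> c1 b \<and> 1 \<le> c2 b}"
    and ?H = "replicate N (43 / 84 :: rat)"
  have "splits N (25 / 168 + 57 / 168 + 43 / 84) (mset xs + mset ys + replicate_mset N (43 / 84))"
  proof (intro splits_add_capacity splits_replicate)
    show "splits N (25 / 168) (mset xs)"
      using xs len by (intro splits_uniform[where c = 1 and w = "25 / 168"]) (auto intro: less_imp_le)
    show "splits N (57 / 168) (mset ys)"
      using ys len by (intro splits_uniform[where c = 1 and w = "57 / 168"]) (auto intro: less_imp_le)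
  qed simp
  then have sp: "splits N 1 (mset ((xs @ ys) @ ?H))" by (simp add: add.assoc)
  have "real (card ?D) + real (length ?H) + real N \<le> C + real N"
  proof (rule cost_bound[OF _ sp])
    fix b h assume bh: "b \<in> ?D" "h \<in> set ?H"
    have "12 \<le> 3 * c1 b + 7 * c2 b" using bh(1) by auto
    then have "of_nat 12 \<le> (of_nat (3 * c1 b + 7 * c2 b) :: rat)" by (simp only: of_nat_le_iff)
    then show "1 < load (xs @ ys) (run A N (xs @ ys)) b + h"
      using load_phase2[of b] bh by simp
  qed (use valid_xs valid_ys in \<open>auto simp: valid_input_def\<close>)
  then show ?thesis by simp
qed

lemma splits_xs_ys: "splits (2 * q) 1 (mset (xs @ ys))"
  using splits_rest[of 0] by (simp add: N)

text \<open>Only ones follow: the two phases fit into \<open>2 * q\<close> bins.\<close>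

lemma cost_stop_after_ys: "real (card B2) + real N \<le> C + 2 * real q"
  using cost_bound[of "xs @ ys" "[]" "2 * q" B2] splits_xs_ys valid_xs valid_ys
  by (simp add: N)

lemma capacity:
  assumes "b \<in> B2"
  shows "3 * c1 b + 7 * c2 b < 21"
proof -
  have "is_packing (xs @ ys) (run A N (xs @ ys))"
    using splits_xs_ys valid_xs valid_ys by (intro run_is_packing[where k = "2 * q"]) (auto simp: N)
  then have "load (xs @ ys) (run A N (xs @ ys)) b \<le> 1" by (simp add: is_packing_iff_load)
  then have "of_nat (3 * c1 b + 7 * c2 b) < (of_nat 21 :: rat)"
    using load_phase2[OF assms] by simp
  then show ?thesis by (simp only: of_nat_less_iff)
qed

lemma bin_nonempty:
  assumes "b \<in> B2"
  shows "c1 b + c2 b \<noteq> 0"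
proof -
  have "run A N (xs @ ys) = run A N xs @ drop N (run A N (xs @ ys))"
    using take_run_append[of xs A N ys] len(1) by (metis append_take_drop_id)
  then have "b \<in> B1 \<or> b \<in> set (drop N (run A N (xs @ ys)))"
    using assms by (metis Un_iff set_append)
  then show ?thesis unfolding c1_def c2_def using count_list_0_iff by fastforce
qed

lemma cost_bound_87_62: "87 / 62 * real N \<le> C + 1"
proof -
  let ?S = "size {#y \<in># mset ys. y \<le> \<eta>#}"
  let ?X2 = "card {b \<in> B2. 2 \<le> c1 b}"
  let ?Y = "card {b \<in> B2. 3 \<le> c1 b \<or> 1 \<le> c2 b}"
  let ?Z = "card {b \<in> B2. 4 \<le> c1 b \<or> 2 \<le> c2 b \<or> 2 \<le> c1 b \<and> 1 \<le> c2 b}"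
  let ?L = "card {b \<in> B2. c1 b = 0}"
  have real_N: "real N = 4 * real q" using N by simp
  have B1: "B1 = {b \<in> B2. 1 \<le> c1 b}" using B1_subset in_B1_iff by auto
  have card_filter: "card {b \<in> B2. P b} = (\<Sum>b\<in>B2. of_bool (P b))" for P
    by (simp add: Int_def)
  have "card B1 = (\<Sum>b\<in>B2. of_bool (1 \<le> c1 b))"
    using arg_cong[OF B1, of card] card_filter[of "\<lambda>b. 1 \<le> c1 b"] by (rule trans)
  note cards = this card_filter
  show ?thesis
  proof (cases "2 * q \<le> ?S")
    case True
    have "5 * (\<Sum>b\<in>B2. c1 b) + 10 * (\<Sum>b\<in>B2. c2 b)
      \<le> 5 * (\<Sum>b\<in>B2. of_bool (1 \<le> c1 b)) + 5 * (\<Sum>b\<in>B2. of_bool (2 \<le> c1 b))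
        + 10 * (\<Sum>b\<in>B2. of_bool (3 \<le> c1 b \<or> 1 \<le> c2 b))
        + 10 * (\<Sum>b\<in>B2. of_bool (4 \<le> c1 b \<or> 2 \<le> c2 b \<or> 2 \<le> c1 b \<and> 1 \<le> c2 b))"
      unfolding sum_distrib_left sum.distrib[symmetric]
      by (intro sum_mono weight_many_small capacity bin_nonempty)
    then have "5 * N + 10 * N \<le> 5 * card B1 + 5 * ?X2 + 10 * ?Y + 10 * ?Z"
      by (simp only: cards sum_c1 sum_c2)
    then have "15 * real N \<le> 5 * real (card B1) + 5 * real ?X2 + 10 * real ?Y + 10 * real ?Z"
      by linarith
    moreover have "real ?Y + 3 * real q \<le> C"
    proof -
      have "(N - 2 * q + 1) div 2 = q" using N by simp
      then show ?thesis using cost_large_after_ys[OF True order_refl] real_N by linarith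
    qed
    \<comment> \<open>Adding the four cost bounds, in the order first-phase large (already scaled by
      6), first-phase medium, second-phase large, second-phase medium, with multipliers 1, 5, 10, 10
      gives \<open>43.5 * N \<le> 31 * C + 5\<close>; this case is the tight one.\<close>
    ultimately show ?thesis
      using cost_large_after_xs cost_medium_after_xs cost_medium_after_ys real_N by linarith
  next
    case False
    have "(\<Sum>b\<in>B2. c1 b) + 2 * (\<Sum>b\<in>B2. c2 b) + (\<Sum>b\<in>B2. of_bool (c1 b = 0))
      \<le> (\<Sum>b\<in>B2. of_bool (2 \<le> c1 b))
        + 2 * (\<Sum>b\<in>B2. of_bool (3 \<le> c1 b \<or> 1 \<le> c2 b))
        + 2 * (\<Sum>b\<in>B2. of_bool (4 \<le> c1 b \<or> 2 \<le> c2 b \<or> 2 \<le> c1 b \<and> 1 \<le> c2 b))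
        + (\<Sum>b\<in>B2. 1)"
      unfolding sum_distrib_left sum.distrib[symmetric]
      by (intro sum_mono weight_few_small capacity bin_nonempty)
    then have "N + 2 * N + ?L \<le> ?X2 + 2 * ?Y + 2 * ?Z + (\<Sum>b\<in>B2. 1)"
      by (simp only: cards sum_c1 sum_c2)
    then have "3 * real N + real ?L \<le> real ?X2 + 2 * real ?Y + 2 * real ?Z + real (card B2)"
      by simp
    moreover have "card B2 = card B1 + ?L"
    proof -
      have "B1 \<inter> {b \<in> B2. c1 b = 0} = {}" by (auto simp: in_B1_iff)
      moreover have "B2 = B1 \<union> {b \<in> B2. c1 b = 0}" using B1_subset in_B1_iff by fastforce
      ultimately show ?thesis
        by (subst \<open>B2 = _\<close>) (intro card_Un_disjoint; simp)
    qed
    \<comment> \<open>The large second-phase items are exactly as many as the bins they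
      open.\<close>
    then have "?S + ?L = N" using small_ys by simp
    then have "2 * ((N - ?S + 1) div 2) \<le> ?L + 1" by linarith
    then have "2 * real ((N - ?S + 1) div 2) \<le> real ?L + 1" by linarith
    moreover have "real ?Y + real N \<le> C + real ((N - ?S + 1) div 2)"
      using False by (intro cost_large_after_ys) auto
    \<comment> \<open>Multipliers 1, 2, 1 for the bounds named here and 2 for the one just derived
      cancel \<open>?L\<close> and give \<open>8.5 * N \<le> 6 * C + 1\<close>, a ratio of 17/12,
      which exceeds 87/62.\<close>
    ultimately show ?thesis
      using cost_medium_after_xs cost_medium_after_ys cost_stop_after_ys real_N by linarith
  qed
qed

end

section \<open>From the two phases to the asymptotic ratio\<close>

lemma (in bounded_ko) lower_bound:
  assumes N: "N = 4 * q"
  shows "87 / 62 * real N \<le> C + 1"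
proof -
  have "(1 / 7 :: rat) < 25 / 168" by simp
  then obtain xs \<theta> where xs: "length xs = N" "1 / 7 \<le> \<theta>" "\<theta> < 25 / 168"
    "\<And>x. x \<in> set xs \<Longrightarrow> 1 / 7 < x \<and> x < 25 / 168"
    "size {#x \<in># mset xs. x \<le> \<theta>#} + card (set (run A N ([] @ xs))) = N + card (set (run A N []))"
    "\<And>b. b \<in> set (run A N ([] @ xs)) \<Longrightarrow> b \<notin> set (run A N []) \<Longrightarrow>
       \<exists>i<N. run A N ([] @ xs) ! (length ([] :: rat list) + i) = b \<and> \<theta> < xs ! i"
    using adaptive_items_opening[of "1 / 7" "25 / 168" N A N "[]"] by metis
  have "(1 / 3 :: rat) < 57 / 168" by simp
  then obtain ys \<eta> where ys: "length ys = N" "1 / 3 \<le> \<eta>" "\<eta> < 57 / 168"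
    "\<And>x. x \<in> set ys \<Longrightarrow> 1 / 3 < x \<and> x < 57 / 168"
    "size {#x \<in># mset ys. x \<le> \<eta>#} + card (set (run A N (xs @ ys))) = N + card (set (run A N xs))"
    "\<And>b. b \<in> set (run A N (xs @ ys)) \<Longrightarrow> b \<notin> set (run A N xs) \<Longrightarrow>
       \<exists>i<N. run A N (xs @ ys) ! (length xs + i) = b \<and> \<eta> < ys ! i"
    using adaptive_items_opening[of "1 / 3" "57 / 168" N A N xs] by metis
  have "run A N [] = []" by (simp add: run_def)
  then interpret two_phases A N C q xs ys \<theta> \<eta>
    using N xs ys by unfold_locales auto
  show ?thesis by (rule cost_bound_87_62)
qed

lemma worst_cost_lower_bound:
  assumes "online_ko_algorithm A"
  shows "ereal (87 / 62 * real (4 * q) - 1) \<le> worst_cost A (4 * q)"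
proof (rule ccontr)
  assume less: "\<not> ereal (87 / 62 * real (4 * q) - 1) \<le> worst_cost A (4 * q)"
  \<comment> \<open>Density supplies a real \<open>C\<close>, although \<open>worst_cost\<close> is
    an extended real.\<close>
  then obtain C where C: "worst_cost A (4 * q) \<le> ereal C" "C < 87 / 62 * real (4 * q) - 1"
    using ereal_dense2[of "worst_cost A (4 * q)" "ereal (87 / 62 * real (4 * q) - 1)"]
    by (auto simp: not_le intro: less_imp_le)
  have "real (alg_cost A J) \<le> C" if "valid_input J" "OPT J = 4 * q" for J
  proof -
    have "ereal (real (alg_cost A J)) \<le> worst_cost A (4 * q)"
      unfolding worst_cost_def using that by (intro SUP_upper) auto
    then show ?thesis using C(1) by (metis ereal_less_eq(3) order_trans)
  qed
  then interpret bounded_ko A "4 * q" C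
    using assms by unfold_locales
  show False using lower_bound[OF refl] C(2) by simp
qed

theorem theorem2:
  fixes A :: ko_algorithm
  assumes "online_ko_algorithm A"
  shows "asymptotic_ratio A \<ge> ereal (87 / 62)"
proof -
  \<comment> \<open>Only optima divisible by 4 were treated, so the limit superior is bounded along
    a subsequence; \<open>Suc\<close> avoids division by 0.\<close>
  let ?u = "\<lambda>Q. worst_cost A Q / ereal (real Q)" and ?r = "\<lambda>q. 4 * Suc q"
  have "(\<lambda>q. 1 / real (?r q)) \<longlonglongrightarrow> 0"
    using LIMSEQ_subseq_LIMSEQ[OF lim_inverse_n', of ?r] by (simp add: strict_mono_def o_def)
  then have "(\<lambda>q. 87 / 62 - 1 / real (?r q)) \<longlonglongrightarrow> 87 / 62 - 0"
    by (intro tendsto_intros)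
  then have "(\<lambda>q. ereal (87 / 62 - 1 / real (?r q))) \<longlonglongrightarrow> ereal (87 / 62)"
    by simp
  from lim_imp_Limsup[OF trivial_limit_sequentially this]
  have "ereal (87 / 62) = limsup (\<lambda>q. ereal (87 / 62 - 1 / real (?r q)))"
    by (rule sym)
  also have "\<dots> \<le> limsup (?u \<circ> ?r)"
  proof (intro Limsup_mono always_eventually allI)
    fix q
    have "ereal (87 / 62 - 1 / real (?r q)) = ereal (87 / 62 * real (?r q) - 1) / ereal (real (?r q))"
      by (simp add: field_simps)
    also have "\<dots> \<le> worst_cost A (?r q) / ereal (real (?r q))"
      by (intro ereal_divide_right_mono worst_cost_lower_bound[OF assms]) auto
    finally show "ereal (87 / 62 - 1 / real (?r q)) \<le> (?u \<circ> ?r) q" by simp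
  qed
  also have "\<dots> \<le> limsup ?u"
    by (rule limsup_subseq_mono) (simp add: strict_mono_def)
  finally show ?thesis by (simp add: asymptotic_ratio_def)
qed

end
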